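(* Let $\Xi=\{\exp(2\pi\mathrm{i}j/2^m): j\in\mathbb Z,\ m\in\mathbb Z_{\ge0}\}$. Let \[ U(q)=\sum_{n=0}^\infty\prod_{j=0}^{n-1}(q^{2^j}-1), \] regarded, for each $\xi\in\Xi$, as a formal power series in $\mathbb C[[q-\xi]]$ (the expansion of $U$ at $\xi$). Let $U_0(q)\in\mathbb C[[q]]$ be the unique formal power series satisfying the Mahler functional equation \[ U_0(q)=1+(q-1)U_0(q^2); \] it converges and defines an analytic function in the open unit disk $|q|<1$. Then for every $\xi\in\Xi$ and every integer $k\ge0$, the radial limit $\lim_{r\to1^-}U_0^{(k)}(r\xi)$ exists and equals $U^{(k)}(\xi)$, the $k$-th derivative of $U$ at $\xi$ (i.e. $k!$ times the coefficient of $(q-\xi)^k$ in the expansion of $U$ at $\xi$). In other words, $U$ and the radial limit of $U_0$ agree at every $\xi\in\Xi$ together with their derivatives of all orders.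
   Context: For $\xi\in\Xi$ with $\xi^{2^m}=1$, each factor $q^{2^j}-1$ with $j\ge m$ vanishes at $q=\xi$, so the $n$-th summand of $U(q)$ vanishes to order at least $n-m$ at $q=\xi$; hence the series defining $U$ converges as a formal power series in $q-\xi$ (coefficientwise), and in particular $U(\xi)$ is a finite sum. The function $U$ satisfies $U(q)=1+(q-1)U(q^2)$. The power series $U_0$ has all coefficients in $\{\pm\tfrac12\}$, e.g. $U_0(q)=\tfrac12(1+q-q^2+q^3+q^4-q^5-\cdots)$. *)

theory Defs
  imports "HOL-Analysis.Analysis"
begin

definition Xi :: "complex set" where
  "Xi = {exp (2 * of_real pi * \<i> * of_int j / 2 ^ m) | (j :: int) (m :: nat). True}"

(* The n-th summand of U expanded at xi: the variable fps_X stands for q - xi, so that q is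
   fps_const xi + fps_X. *)
definition U_summand :: "complex \<Rightarrow> nat \<Rightarrow> complex fps" where
  "U_summand \<xi> n = (\<Prod>j<n. (fps_const \<xi> + fps_X) ^ (2 ^ j) - 1)"

(* The infinite sum is taken in the metric topology of formal power series, in which convergence
   means that every coefficient is eventually constant. *)
definition U_at :: "complex \<Rightarrow> complex fps" where
  "U_at \<xi> = (\<Sum>n. U_summand \<xi> n)"

definition mahler_eq :: "complex fps \<Rightarrow> bool" where
  "mahler_eq F \<longleftrightarrow> F = 1 + (fps_X - 1) * fps_compose F (fps_X ^ 2)"

definition U0 :: "complex fps" where
  "U0 = (THE F. mahler_eq F)"

end

theory Submission
  imports Defs
begin

text \<open>
  Iterating the Mahler equation \<open>N\<close> times gives
  \<open>U\<^sub>0(q) = S\<^sub>N(q) + P\<^sub>N(q) U\<^sub>0(q ^ 2 ^ N)\<close>, where \<open>S\<^sub>N\<close> is the \<open>N\<close>-th partial sum of the series for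
  \<open>U\<close> and \<open>P\<^sub>N\<close> its \<open>N\<close>-th summand. At a \<open>2 ^ m\<close>-th root of unity \<open>\<xi>\<close> the polynomial \<open>P\<^sub>N\<close> vanishes to
  order \<open>N - m\<close>. The coefficients of \<open>U\<^sub>0(q ^ 2 ^ N)\<close> are bounded by 1/2 for every \<open>N\<close>, so its \<open>k\<close>-th
  derivative grows at most like \<open>(1 - \<bar>q\<bar>) ^ -(k + 1)\<close>, with an exponent independent of \<open>N\<close>. For \<open>N\<close>
  large compared to \<open>k\<close> the zero of \<open>P\<^sub>N\<close> wins, and the \<open>k\<close>-th derivatives of \<open>U\<^sub>0\<close> and \<open>S\<^sub>N\<close> have the same
  radial limit at \<open>\<xi>\<close>.
\<close>

section \<open>Power series with coefficients of polynomial growth\<close>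

text \<open>The numbers \<open>(n + d) choose d\<close> are the coefficients of (1 - x)^-(d + 1).
  Compared with n^d, they give a closed form when summed against r^n, and differentiation raises
  \<open>d\<close> by exactly one. The case \<open>d = 0\<close> means bounded coefficients.\<close>

definition poly_growth :: "nat \<Rightarrow> complex fps \<Rightarrow> bool" where
  "poly_growth d F \<longleftrightarrow> (\<exists>C\<ge>0. \<forall>n. norm (fps_nth F n) \<le> C * real ((n + d) choose d))"

lemma poly_growthI:
  assumes "C \<ge> 0" "\<And>n. norm (fps_nth F n) \<le> C * real ((n + d) choose d)"
  shows "poly_growth d F"
  using assms unfolding poly_growth_def by blast

lemma poly_growthE:
  assumes "poly_growth d F"
  obtains C where "C \<ge> 0" "\<And>n. norm (fps_nth F n) \<le> C * real ((n + d) choose d)"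
  using assms unfolding poly_growth_def by blast

lemma poly_growth_add:
  assumes "poly_growth d F" "poly_growth d G"
  shows "poly_growth d (F + G)"
proof -
  obtain C where C: "C \<ge> 0" "\<And>n. norm (fps_nth F n) \<le> C * real ((n + d) choose d)"
    using assms(1) by (rule poly_growthE) blast
  obtain D where D: "D \<ge> 0" "\<And>n. norm (fps_nth G n) \<le> D * real ((n + d) choose d)"
    using assms(2) by (rule poly_growthE) blast
  show ?thesis
  proof (rule poly_growthI[of "C + D"])
    show "norm (fps_nth (F + G) n) \<le> (C + D) * real ((n + d) choose d)" for n
      using norm_triangle_mono[OF C(2)[of n] D(2)[of n]] by (simp add: distrib_right)
  qed (use C(1) D(1) in simp)
qed

lemma poly_growth_const_mult:
  assumes "poly_growth d F"
  shows "poly_growth d (fps_const c * F)"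
proof -
  obtain C where C: "C \<ge> 0" "\<And>n. norm (fps_nth F n) \<le> C * real ((n + d) choose d)"
    using assms by (rule poly_growthE) blast
  show ?thesis
  proof (rule poly_growthI[of "norm c * C"])
    show "norm (fps_nth (fps_const c * F) n) \<le> norm c * C * real ((n + d) choose d)" for n
      using mult_left_mono[OF C(2)[of n] norm_ge_zero[of c]] by (simp add: norm_mult mult.assoc)
  qed (use C(1) in simp)
qed

lemma poly_growth_X_mult:
  assumes "poly_growth d F"
  shows "poly_growth d (fps_X * F)"
proof -
  obtain C where C: "C \<ge> 0" "\<And>n. norm (fps_nth F n) \<le> C * real ((n + d) choose d)"
    using assms by (rule poly_growthE) blast
  show ?thesis
  proof (rule poly_growthI[OF C(1)])
    show "norm (fps_nth (fps_X * F) n) \<le> C * real ((n + d) choose d)" for n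
    proof (cases n)
      case (Suc n')
      have "norm (fps_nth F n') \<le> C * real ((n' + d) choose d)" by (rule C(2))
      also have "\<dots> \<le> C * real ((n + d) choose d)"
        using C(1) Suc by (intro mult_left_mono of_nat_mono binomial_right_mono) auto
      finally show ?thesis using Suc by simp
    qed (use C(1) in simp)
  qed
qed

lemma poly_growth_0: "poly_growth d 0"
  by (rule poly_growthI[of 0]) auto

lemma poly_growth_poly_mult:
  assumes "poly_growth d F"
  shows "poly_growth d (fps_of_poly p * F)"
proof (induction p)
  case (pCons a p)
  have "fps_of_poly (pCons a p) * F = fps_const a * F + fps_X * (fps_of_poly p * F)"
    by (simp add: fps_of_poly_pCons algebra_simps)
  then show ?case
    using assms pCons.IH by (simp add: poly_growth_add poly_growth_const_mult poly_growth_X_mult)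
qed (simp add: poly_growth_0)

text \<open>The product rule produces terms in both F and its derivative; this brings F to the
  growth order of the derivative so that they can be added.\<close>

lemma poly_growth_Suc:
  assumes "poly_growth d F"
  shows "poly_growth (Suc d) F"
proof -
  obtain C where C: "C \<ge> 0" "\<And>n. norm (fps_nth F n) \<le> C * real ((n + d) choose d)"
    using assms by (rule poly_growthE) blast
  show ?thesis
  proof (rule poly_growthI[OF C(1)])
    show "norm (fps_nth F n) \<le> C * real ((n + Suc d) choose Suc d)" for n
    proof -
      have "C * real ((n + d) choose d) \<le> C * real ((n + Suc d) choose Suc d)"
        using C(1) by (intro mult_left_mono) auto
      with C(2)[of n] show ?thesis by linarith
    qed
  qed
qed

lemma poly_growth_deriv:
  assumes "poly_growth d F"
  shows "poly_growth (Suc d) (fps_deriv F)"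
proof -
  obtain C where C: "C \<ge> 0" "\<And>n. norm (fps_nth F n) \<le> C * real ((n + d) choose d)"
    using assms by (rule poly_growthE) blast
  show ?thesis
  proof (rule poly_growthI[of "C * real (Suc d)"])
    show "norm (fps_nth (fps_deriv F) n) \<le> C * real (Suc d) * real ((n + Suc d) choose Suc d)" for n
    proof -
      \<comment> \<open>Absorption turns the factor n + 1 coming from the derivative into the
        constant d + 1 and raises the lower index of the binomial coefficient by one.\<close>
      have "Suc d * (Suc (n + d) choose Suc d) = (Suc (n + d) - d) * (Suc (n + d) choose d)"
        by (rule trans[OF binomial_absorption binomial_absorb_comp[symmetric]])
      moreover have "Suc (n + d) - d = Suc n" by simp
      ultimately have "Suc d * ((n + Suc d) choose Suc d) = Suc n * ((Suc n + d) choose d)"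
        by (simp only: add_Suc add_Suc_right)
      then have eq: "real (Suc d) * real ((n + Suc d) choose Suc d) =
          real (Suc n) * real ((Suc n + d) choose d)"
        by (simp only: of_nat_mult[symmetric])
      have "norm (fps_nth (fps_deriv F) n) = real (Suc n) * norm (fps_nth F (Suc n))"
        by (simp add: norm_mult del: of_nat_Suc)
      also have "\<dots> \<le> real (Suc n) * (C * real ((Suc n + d) choose d))"
        by (intro mult_left_mono C(2)) auto
      also have "\<dots> = C * real (Suc d) * real ((n + Suc d) choose Suc d)"
        using eq by (simp only: mult_ac)
      finally show ?thesis .
    qed
  qed (use C(1) in simp)
qed

section \<open>Convergence, size and derivatives of the sum in the unit disk\<close>

lemma negative_binomial_series:
  fixes r :: real
  assumes "0 \<le> r" "r < 1"
  shows "(\<lambda>n. real ((n + d) choose d) * r ^ n) sums (1 / (1 - r) ^ Suc d)"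
proof -
  \<comment> \<open>Newton's binomial series with exponent -(d + 1) at -r; the sign (-1)^n of the
    generalized binomial coefficient cancels that of (-r)^n.\<close>
  have "(\<lambda>n. ((- real (Suc d)) gchoose n) * (- r) ^ n) sums (1 + (- r)) powr (- real (Suc d))"
    using assms by (intro gen_binomial_real) auto
  moreover have "((- real (Suc d)) gchoose n) * (- r) ^ n = real ((n + d) choose d) * r ^ n" for n
  proof -
    have "((n + d) choose n) = ((n + d) choose d)"
      using binomial_symmetric[of n "n + d"] by simp
    then have "real (n + d) gchoose n = real ((n + d) choose d)"
      by (simp only: binomial_gbinomial[symmetric])
    moreover have "real (Suc d) + real n - 1 = real (n + d)" by simp
    ultimately have "((- real (Suc d)) gchoose n) * (- r) ^ n =
        ((-1) ^ n * (- r) ^ n) * real ((n + d) choose d)"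
      by (simp only: gbinomial_minus mult_ac)
    moreover have "(-1) ^ n * (- r) ^ n = r ^ n"
      by (simp flip: power_mult_distrib)
    ultimately show ?thesis by (simp only: mult.commute)
  qed
  moreover have "(1 + (- r)) powr (- real (Suc d)) = 1 / (1 - r) ^ Suc d"
    using assms by (simp add: powr_minus powr_realpow divide_inverse del: of_nat_Suc power_Suc)
  ultimately show ?thesis by simp
qed

lemma poly_growth_summable:
  assumes "poly_growth d F" "0 \<le> r" "r < 1"
  shows "summable (\<lambda>n. norm (fps_nth F n) * r ^ n)"
proof -
  obtain C where C: "C \<ge> 0" "\<And>n. norm (fps_nth F n) \<le> C * real ((n + d) choose d)"
    using assms(1) by (rule poly_growthE) blast
  have "summable (\<lambda>n. C * (real ((n + d) choose d) * r ^ n))"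
    using negative_binomial_series[OF assms(2,3)] by (intro summable_mult) (rule sums_summable)
  moreover have "norm (norm (fps_nth F n) * r ^ n) \<le> C * (real ((n + d) choose d) * r ^ n)" for n
    using mult_right_mono[OF C(2)[of n], of "r ^ n"] assms(2) by (simp add: mult.assoc)
  ultimately show ?thesis by (rule summable_comparison_test')
qed

lemma poly_growth_conv_radius:
  assumes "poly_growth d F"
  shows "fps_conv_radius F \<ge> 1"
  unfolding fps_conv_radius_def
proof (rule conv_radius_geI_ex)
  fix r :: real assume r: "0 < r" "ereal r < 1"
  have "summable (\<lambda>n. norm (fps_nth F n * of_real r ^ n))"
    using poly_growth_summable[OF assms, of r] r by (simp add: norm_mult norm_power)
  then have "summable (\<lambda>n. fps_nth F n * of_real r ^ n)"
    by (rule summable_norm_cancel)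
  then show "\<exists>z. norm z = r \<and> summable (\<lambda>n. fps_nth F n * z ^ n)"
    using r by (intro exI[of _ "of_real r"]) auto
qed

text \<open>Termwise comparison with the negative binomial series at |z|; the constant is the one
  from the coefficients, hence the same for all z.\<close>

lemma poly_growth_eval_bound:
  assumes "poly_growth d F"
  obtains C where "\<And>z. norm z < 1 \<Longrightarrow> norm (eval_fps F z) \<le> C / (1 - norm z) ^ Suc d"
proof -
  obtain C where C: "C \<ge> 0" "\<And>n. norm (fps_nth F n) \<le> C * real ((n + d) choose d)"
    using assms by (rule poly_growthE) blast
  have "norm (eval_fps F z) \<le> C / (1 - norm z) ^ Suc d" if z: "norm z < 1" for z
  proof -
    have sums: "(\<lambda>n. C * (real ((n + d) choose d) * norm z ^ n)) sums (C * (1 / (1 - norm z) ^ Suc d))"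
      using z by (intro sums_mult negative_binomial_series) auto
    have "norm (eval_fps F z) \<le> (\<Sum>n. norm (fps_nth F n * z ^ n))"
      unfolding eval_fps_def using poly_growth_summable[OF assms, of "norm z"] z
      by (intro summable_norm) (simp add: norm_mult norm_power)
    also have "\<dots> \<le> (\<Sum>n. C * (real ((n + d) choose d) * norm z ^ n))"
    proof (rule suminf_le)
      show "norm (fps_nth F n * z ^ n) \<le> C * (real ((n + d) choose d) * norm z ^ n)" for n
        using mult_right_mono[OF C(2)[of n], of "norm z ^ n"]
        by (simp add: norm_mult norm_power mult.assoc)
      show "summable (\<lambda>n. norm (fps_nth F n * z ^ n))"
        using poly_growth_summable[OF assms, of "norm z"] z by (simp add: norm_mult norm_power)
    qed (use sums in \<open>rule sums_summable\<close>)
    also have "\<dots> = C / (1 - norm z) ^ Suc d"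
      using sums by (simp add: sums_iff)
    finally show ?thesis .
  qed
  then show ?thesis by (rule that)
qed

lemma higher_deriv_eval_fps:
  fixes F :: "complex fps"
  assumes "norm z < fps_conv_radius F"
  shows "(deriv ^^ k) (eval_fps F) z = eval_fps ((fps_deriv ^^ k) F) z"
  using assms
proof (induction k arbitrary: F)
  case (Suc k)
  \<comment> \<open>The first derivatives must agree on a whole neighbourhood of z before the
    remaining k derivatives can be compared at z.\<close>
  have "\<forall>\<^sub>F w in nhds z. w \<in> eball 0 (fps_conv_radius F)"
    using Suc.prems by (intro eventually_nhds_in_open) auto
  then have "\<forall>\<^sub>F w in nhds z. deriv (eval_fps F) w = eval_fps (fps_deriv F) w"
    by eventually_elim (simp add: eval_fps_deriv)
  then have "(deriv ^^ k) (deriv (eval_fps F)) z = (deriv ^^ k) (eval_fps (fps_deriv F)) z"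
    by (intro higher_deriv_cong_ev refl)
  also have "\<dots> = eval_fps ((fps_deriv ^^ k) (fps_deriv F)) z"
    using Suc.prems fps_conv_radius_deriv[of F] by (intro Suc.IH) auto
  finally show ?case by (simp add: funpow_Suc_right del: funpow.simps)
qed simp

section \<open>Radial limits at a zero of high order\<close>

text \<open>Each derivative costs one order of the zero and one order of growth, because (l^(s+1)
  F)' = l^s ((s+1) F + l F') for l = q - xi.\<close>

lemma higher_deriv_power_mult:
  assumes "poly_growth d F"
  obtains G where "poly_growth (d + k) G"
    "(fps_deriv ^^ k) (fps_of_poly ([:-\<xi>, 1:] ^ (M + k)) * F) = fps_of_poly ([:-\<xi>, 1:] ^ M) * G"
proof -
  let ?l = "fps_of_poly [:-\<xi>, 1:]"
  have "\<exists>G. poly_growth (d + k) G \<and> (fps_deriv ^^ k) (?l ^ (M + k) * F) = ?l ^ M * G"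
    using assms
  proof (induction k arbitrary: d F)
    case (Suc k)
    \<comment> \<open>The cofactor left after one derivative once l^(M+k) is taken out; the
      induction hypothesis applies to it with d + 1 in place of d.\<close>
    define H where "H = fps_const (of_nat (Suc (M + k))) * F + ?l * fps_deriv F"
    have H: "poly_growth (Suc d) H"
      unfolding H_def using Suc.prems
      by (intro poly_growth_add poly_growth_const_mult poly_growth_poly_mult poly_growth_Suc
          poly_growth_deriv)
    have "fps_deriv ?l = 1"
      by (simp add: fps_of_poly_pderiv[symmetric] pderiv_pCons)
    then have "fps_deriv (?l ^ Suc (M + k)) = fps_const (of_nat (Suc (M + k))) * ?l ^ (M + k)"
      by (simp only: fps_deriv_power diff_Suc_1 mult_1_right)
    then have "fps_deriv (?l ^ Suc (M + k) * F) =
        ?l * ?l ^ (M + k) * fps_deriv F + fps_const (of_nat (Suc (M + k))) * ?l ^ (M + k) * F"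
      by (simp only: fps_deriv_mult power_Suc)
    then have "fps_deriv (?l ^ (M + Suc k) * F) = ?l ^ (M + k) * H"
      by (simp only: H_def add_Suc_right distrib_left) (simp only: ac_simps)
    with Suc.IH[OF H] show ?case
      by (simp add: funpow_Suc_right del: funpow.simps power_Suc)
  qed auto
  then show ?thesis using that by (auto simp: fps_of_poly_power)
qed

text \<open>After k derivatives a zero of order M - k >= k + 2 remains, against growth of order k +
  1 in 1/(1 - r). A factor 1 - r survives and forces the limit 0.\<close>

lemma radial_limit_higher_deriv:
  assumes F: "poly_growth 0 F" and \<xi>: "norm \<xi> = 1" and k: "M \<ge> 2 * k + 2"
  shows "((\<lambda>r::real. eval_fps ((fps_deriv ^^ k) (fps_of_poly ([:-\<xi>, 1:] ^ M) * F)) (of_real r * \<xi>))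
    \<longlongrightarrow> 0) (at_left 1)"
proof -
  define L where "L = M - k"
  have L: "M = L + k" "L \<ge> Suc (Suc k)" using k by (auto simp: L_def)
  obtain G where G: "poly_growth (0 + k) G"
    "(fps_deriv ^^ k) (fps_of_poly ([:-\<xi>, 1:] ^ (L + k)) * F) = fps_of_poly ([:-\<xi>, 1:] ^ L) * G"
    using higher_deriv_power_mult[OF F] by blast
  obtain C where C: "\<And>z. norm z < 1 \<Longrightarrow> norm (eval_fps G z) \<le> C / (1 - norm z) ^ Suc k"
    using poly_growth_eval_bound[OF G(1)] by auto
  have "\<forall>\<^sub>F r::real in at_left 1. r \<in> {0<..<1}"
    by (rule eventually_at_left_real) simp
  then have "\<forall>\<^sub>F r::real in at_left 1.
      norm (eval_fps (fps_of_poly ([:-\<xi>, 1:] ^ L) * G) (of_real r * \<xi>)) \<le> C * (1 - r)"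
  proof eventually_elim
    case (elim r)
    have r: "0 < r" "r < 1" using elim by auto
    have nz: "norm (of_real r * \<xi>) = r" using r \<xi> by (simp add: norm_mult)
    have "of_real r * \<xi> - \<xi> = - (of_real (1 - r) * \<xi>)" by (simp add: algebra_simps)
    then have nl: "norm (of_real r * \<xi> - \<xi>) = 1 - r"
      using r \<xi> by (simp only: norm_minus_cancel norm_mult norm_of_real) simp
    \<comment> \<open>The sign of C, required for multiplying the two estimates, is read off from
      the bound at z = 0.\<close>
    have "0 \<le> norm (eval_fps G 0)" by simp
    also have "\<dots> \<le> C" using C[of 0] by simp
    finally have "C \<ge> 0" .
    have "ereal (norm (of_real r * \<xi>)) < fps_conv_radius G"
      using nz r by (intro order_less_le_trans[OF _ poly_growth_conv_radius[OF G(1)]]) simp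
    then have "eval_fps (fps_of_poly ([:-\<xi>, 1:] ^ L) * G) (of_real r * \<xi>) =
        (of_real r * \<xi> - \<xi>) ^ L * eval_fps G (of_real r * \<xi>)"
      by (simp add: eval_fps_mult poly_power)
    then have "norm (eval_fps (fps_of_poly ([:-\<xi>, 1:] ^ L) * G) (of_real r * \<xi>)) =
        (1 - r) ^ L * norm (eval_fps G (of_real r * \<xi>))"
      by (simp add: norm_mult norm_power nl)
    also have "\<dots> \<le> (1 - r) ^ Suc (Suc k) * (C / (1 - r) ^ Suc k)"
      using r C[of "of_real r * \<xi>"] nz L(2) \<open>C \<ge> 0\<close>
      by (intro mult_mono power_decreasing) (auto simp del: power_Suc)
    also have "\<dots> = C * (1 - r)" using r by simp
    finally show ?case .
  qed
  moreover have "((\<lambda>r::real. C * (1 - r)) \<longlongrightarrow> 0) (at_left 1)"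
    by (auto intro!: tendsto_eq_intros)
  ultimately have "((\<lambda>r::real. eval_fps (fps_of_poly ([:-\<xi>, 1:] ^ L) * G) (of_real r * \<xi>)) \<longlongrightarrow> 0) (at_left 1)"
    by (rule Lim_null_comparison)
  then show ?thesis by (simp only: L(1) G(2))
qed

section \<open>The Mahler equation\<close>

lemma fps_nth_compose_X_power:
  fixes F :: "'a::comm_ring_1 fps"
  assumes "d > 0"
  shows "fps_nth (fps_compose F (fps_X ^ d)) n = (if d dvd n then fps_nth F (n div d) else 0)"
proof -
  have "fps_nth (fps_compose F (fps_X ^ d)) n = (\<Sum>i=0..n. if n = d * i then fps_nth F i else 0)"
    unfolding fps_compose_nth
    by (intro sum.cong) (auto simp: fps_X_power_nth simp flip: power_mult)
  also have "\<dots> = (if d dvd n then fps_nth F (n div d) else 0)"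
  proof (cases "d dvd n")
    case True
    then have "n = d * i \<longleftrightarrow> i = n div d" for i using assms by auto
    then show ?thesis using True by simp
  qed (auto intro!: sum.neutral)
  finally show ?thesis .
qed

lemma nat_halving_cases:
  obtains "n = (0::nat)" | l where "l > 0" "n = 2 * l" | l where "n = Suc (2 * l)"
proof (cases "even n")
  case True
  then obtain l where "n = 2 * l" by (rule evenE)
  then show ?thesis using that(1,2) by (cases "l = 0") auto
next
  case False
  then obtain l where "n = 2 * l + 1" by (rule oddE)
  then show ?thesis using that(3) by simp
qed

text \<open>F(q^2) has only even powers, so in (q - 1) F(q^2) the factor q fills the odd positions
  and -1 the even ones, without overlap. Position 0 also receives the summand 1, which gives a = 1 -
  a for the constant coefficient.\<close>

lemma mahler_eq_coeff_iff:
  "mahler_eq F \<longleftrightarrow> fps_nth F 0 = 1 / 2 \<and> (\<forall>l>0. fps_nth F (2 * l) = - fps_nth F l) \<and>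
    (\<forall>l. fps_nth F (Suc (2 * l)) = fps_nth F l)"
    (is "_ \<longleftrightarrow> ?R")
proof -
  define G where "G = 1 + (fps_X - 1) * fps_compose F (fps_X ^ 2)"
  have nth: "fps_nth G n = (if n = 0 then 1 else 0) +
      (if odd n then fps_nth F (n div 2) else 0) - (if even n then fps_nth F (n div 2) else 0)" for n
    unfolding G_def by (cases n) (auto simp: left_diff_distrib fps_nth_compose_X_power)
  have G: "fps_nth G 0 = 1 - fps_nth F 0"
    "\<And>l. l > 0 \<Longrightarrow> fps_nth G (2 * l) = - fps_nth F l"
    "\<And>l. fps_nth G (Suc (2 * l)) = fps_nth F l"
    by (simp_all add: nth)
  have half: "fps_nth F 0 = 1 - fps_nth F 0 \<longleftrightarrow> fps_nth F 0 = 1 / 2"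
    by (auto simp: field_simps)
  show ?thesis
  proof
    assume "mahler_eq F"
    then have eq: "F = G" unfolding mahler_eq_def G_def .
    show ?R using G[folded eq] half by blast
  next
    assume R: ?R
    have "fps_nth F n = fps_nth G n" for n
      by (cases n rule: nat_halving_cases) (use R G half in auto)
    then show "mahler_eq F" unfolding mahler_eq_def G_def[symmetric] by (rule fps_ext)
  qed
qed

text \<open>Induction along binary digits, matching the coefficient recursion. The even step
  excludes l = 0, where that recursion has its exceptional value.\<close>

lemma nat_halving_induct:
  assumes "P 0" "\<And>l. l > 0 \<Longrightarrow> P l \<Longrightarrow> P (2 * l)" "\<And>l. P l \<Longrightarrow> P (Suc (2 * l))"
  shows "P (n::nat)"
proof (induction n rule: less_induct)
  case (less n)
  then show ?case using assms by (cases n rule: nat_halving_cases) auto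
qed

text \<open>The existence witness: 1/2 times (-1) to the number of zeros in the binary expansion of
  n, with 0 having the empty expansion.\<close>

fun mahler_coeff :: "nat \<Rightarrow> complex" where
  "mahler_coeff n = (if n = 0 then 1 / 2 else if even n then - mahler_coeff (n div 2)
    else mahler_coeff (n div 2))"

declare mahler_coeff.simps [simp del]

lemma mahler_eq_ex1: "\<exists>!F. mahler_eq F"
proof (rule ex1I)
  show M: "mahler_eq (Abs_fps mahler_coeff)"
    unfolding mahler_eq_coeff_iff
    by (auto simp: mahler_coeff.simps[of 0] mahler_coeff.simps[of "2 * _"]
        mahler_coeff.simps[of "Suc (2 * _)"])
  fix F assume F: "mahler_eq F"
  have "fps_nth F n = fps_nth (Abs_fps mahler_coeff) n" for n
    using F M unfolding mahler_eq_coeff_iff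
    by (induction n rule: nat_halving_induct) (simp_all del: eq_divide_eq_numeral1)
  then show "F = Abs_fps mahler_coeff" by (rule fps_ext)
qed

lemma mahler_eq_U0: "mahler_eq U0"
  unfolding U0_def by (rule theI') (rule mahler_eq_ex1)

lemma norm_U0_nth: "norm (fps_nth U0 n) = 1 / 2"
  using mahler_eq_U0 unfolding mahler_eq_coeff_iff
  by (induction n rule: nat_halving_induct) (simp_all del: eq_divide_eq_numeral1 add: norm_divide)

text \<open>Substituting a power of q only spreads the coefficients apart, so the bound 1/2 is
  uniform in N.\<close>

lemma poly_growth_U0_compose: "poly_growth 0 (fps_compose U0 (fps_X ^ (2 ^ N)))"
  by (rule poly_growthI[of "1 / 2"]) (auto simp: fps_nth_compose_X_power norm_U0_nth)

lemma poly_growth_U0: "poly_growth 0 U0"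
  by (rule poly_growthI[of "1 / 2"]) (auto simp: norm_U0_nth)

section \<open>The summands as polynomials\<close>

text \<open>A polynomial in q itself, independent of the point of expansion: it serves both the
  series at 0 and, after a shift, those at every xi.\<close>

definition summand_poly :: "nat \<Rightarrow> complex poly" where
  "summand_poly n = (\<Prod>j<n. monom 1 (2 ^ j) - 1)"

lemma fps_X_power_compose:
  "fps_compose (fps_X ^ a :: complex fps) (fps_X ^ b) = fps_X ^ (a * b)" if "b > 0"
  using that by (simp add: fps_compose_power[symmetric] mult.commute flip: power_mult)

lemma U0_expansion:
  "U0 = fps_of_poly (\<Sum>n<N. summand_poly n) +
    fps_of_poly (summand_poly N) * fps_compose U0 (fps_X ^ (2 ^ N))"
proof (induction N)
  case (Suc N)
  let ?X = "fps_X ^ (2 ^ N) :: complex fps"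
  have X0: "fps_nth ?X 0 = 0" by simp
  \<comment> \<open>The Mahler equation with q replaced by q^(2^N), to be inserted into the
    remainder of the previous stage.\<close>
  have "fps_compose U0 ?X = fps_compose (1 + (fps_X - 1) * fps_compose U0 (fps_X ^ 2)) ?X"
    using mahler_eq_U0 unfolding mahler_eq_def by (rule arg_cong)
  also have "\<dots> = 1 + (?X - 1) * fps_compose (fps_compose U0 (fps_X ^ 2)) ?X"
    using X0 by (simp add: fps_compose_add_distrib fps_compose_mult_distrib fps_compose_sub_distrib)
  also have "fps_compose (fps_compose U0 (fps_X ^ 2)) ?X = fps_compose U0 (fps_X ^ (2 ^ Suc N))"
    using X0 by (subst fps_compose_assoc[symmetric]) (auto simp: fps_X_power_compose)
  finally have step: "fps_compose U0 ?X = 1 + (?X - 1) * fps_compose U0 (fps_X ^ (2 ^ Suc N))" .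
  have P: "fps_of_poly (summand_poly (Suc N)) = fps_of_poly (summand_poly N) * (?X - 1)"
    by (simp add: summand_poly_def fps_of_poly_mult fps_of_poly_diff fps_of_poly_monom')
  show ?case
    by (rule trans[OF Suc.IH[unfolded step]])
      (simp only: P sum.lessThan_Suc fps_of_poly_add distrib_left mult_1_right mult.assoc add.assoc)
qed (simp add: summand_poly_def)

lemma pcompose_power: "pcompose (p ^ n) q = pcompose p q ^ n" for p q :: "'a::comm_ring_1 poly"
  by (induction n) (simp_all add: pcompose_mult pcompose_1)

lemma U_summand_eq: "U_summand \<xi> n = fps_of_poly (pcompose (summand_poly n) [:\<xi>, 1:])"
proof -
  have "pcompose (summand_poly n) [:\<xi>, 1:] = (\<Prod>j<n. [:\<xi>, 1:] ^ (2 ^ j) - 1)"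
    by (simp add: summand_poly_def pcompose_prod pcompose_diff pcompose_power
        pcompose_smult pcompose_pCons pcompose_1 monom_altdef)
  then show ?thesis
    by (simp add: U_summand_def fps_of_poly_prod fps_of_poly_diff fps_of_poly_power
        fps_of_poly_linear add.commute)
qed

text \<open>Every factor with index j >= m vanishes at xi, since 2^m divides 2^j, and there are n -
  m of these. For n <= m the truncated exponent is 0.\<close>

lemma summand_poly_dvd:
  assumes "\<xi> ^ (2 ^ m) = 1"
  shows "[:-\<xi>, 1:] ^ (n - m) dvd summand_poly n"
proof (induction n)
  case (Suc n)
  show ?case
  proof (cases "m \<le> n")
    case True
    have "\<xi> ^ (2 ^ n) = (\<xi> ^ (2 ^ m)) ^ (2 ^ (n - m))"
      using True by (simp flip: power_mult power_add)
    then have "[:-\<xi>, 1:] dvd monom 1 (2 ^ n) - 1"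
      using assms by (simp add: poly_eq_0_iff_dvd[symmetric] poly_monom)
    with Suc.IH have "[:-\<xi>, 1:] ^ (n - m) * [:-\<xi>, 1:] dvd summand_poly n * (monom 1 (2 ^ n) - 1)"
      by (rule mult_dvd_mono)
    then show ?thesis using True by (simp add: summand_poly_def Suc_diff_le mult.commute)
  qed simp
qed simp

section \<open>Coefficients and derivatives of U at a root of unity\<close>

lemma U_summand_nth_eq_0:
  assumes "\<xi> ^ (2 ^ m) = 1" "n \<ge> Suc (m + k)"
  shows "fps_nth (U_summand \<xi> n) k = 0"
proof -
  obtain R where "summand_poly n = [:-\<xi>, 1:] ^ (n - m) * R"
    using summand_poly_dvd[OF assms(1)] by (metis dvdE)
  \<comment> \<open>The shift turns (q - xi)^(n - m) into X^(n - m), and n - m > k, so coefficient k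
    is zero.\<close>
  then have "pcompose (summand_poly n) [:\<xi>, 1:] = monom 1 (n - m) * pcompose R [:\<xi>, 1:]"
    by (simp add: pcompose_mult pcompose_power pcompose_pCons monom_altdef)
  then show ?thesis
    using assms(2) by (simp add: U_summand_eq coeff_monom_mult)
qed

lemma U_summand_sums:
  assumes "\<xi> ^ (2 ^ m) = 1"
  shows "U_summand \<xi> sums Abs_fps (\<lambda>k. \<Sum>n<Suc (m + k). fps_nth (U_summand \<xi> n) k)"
  unfolding sums_def
proof (rule tendsto_fpsI)
  fix k
  show "\<forall>\<^sub>F N in sequentially. fps_nth (\<Sum>n<N. U_summand \<xi> n) k =
      fps_nth (Abs_fps (\<lambda>k. \<Sum>n<Suc (m + k). fps_nth (U_summand \<xi> n) k)) k"
    using eventually_ge_at_top[of "Suc (m + k)"]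
  proof eventually_elim
    case (elim N)
    then show ?case
      unfolding fps_sum_nth fps_nth_Abs_fps
      by (intro sum.mono_neutral_right) (auto intro!: U_summand_nth_eq_0[OF assms])
  qed
qed

text \<open>Summands from index m + k + 1 on contribute nothing to coefficient k. The cutoff N is
  left free so that it can be matched with the N of \<open>U0_expansion\<close>.\<close>

lemma U_at_nth:
  assumes "\<xi> ^ (2 ^ m) = 1" "N \<ge> Suc (m + k)"
  shows "fps_nth (U_at \<xi>) k = (\<Sum>n<N. fps_nth (U_summand \<xi> n) k)"
proof -
  have "fps_nth (U_at \<xi>) k = (\<Sum>n<Suc (m + k). fps_nth (U_summand \<xi> n) k)"
    using U_summand_sums[OF assms(1)] by (simp add: U_at_def sums_iff)
  also have "\<dots> = (\<Sum>n<N. fps_nth (U_summand \<xi> n) k)"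
    using assms(2) by (intro sum.mono_neutral_left) (auto intro!: U_summand_nth_eq_0[OF assms(1)])
  finally show ?thesis .
qed

text \<open>Taylor's formula: the shift by a commutes with \<open>pderiv\<close>, because the inner
  derivative is 1, so the value at a becomes a constant coefficient.\<close>

lemma poly_higher_pderiv_conv_pcompose:
  fixes p :: "'a::field_char_0 poly"
  shows "poly ((pderiv ^^ k) p) a = fact k * coeff (pcompose p [:a, 1:]) k"
proof -
  have "pcompose (pderiv q) [:a, 1:] = pderiv (pcompose q [:a, 1:])" for q
    by (simp add: pderiv_pcompose pderiv_pCons)
  then have "pcompose ((pderiv ^^ k) p) [:a, 1:] = (pderiv ^^ k) (pcompose p [:a, 1:])"
    by (induction k) simp_all
  then have "coeff (pcompose ((pderiv ^^ k) p) [:a, 1:]) 0 = fact k * coeff (pcompose p [:a, 1:]) k"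
    by (simp add: coeff_higher_pderiv pochhammer_fact)
  then show ?thesis by (simp add: poly_pcompose flip: poly_0_coeff_0)
qed

lemma fps_deriv_funpow_of_poly:
  "(fps_deriv ^^ k) (fps_of_poly p) = fps_of_poly ((pderiv ^^ k) p)"
  by (induction k) (simp_all add: fps_of_poly_pderiv)

lemma fps_deriv_funpow_add:
  "(fps_deriv ^^ k) (F + G) = (fps_deriv ^^ k) F + (fps_deriv ^^ k) (G :: complex fps)"
  by (induction k) simp_all

lemma fps_conv_radius_funpow_deriv:
  "fps_conv_radius ((fps_deriv ^^ k) F) \<ge> fps_conv_radius (F :: complex fps)"
  by (induction k) (auto intro: order_trans fps_conv_radius_deriv)

section \<open>The radial limit at points of \<open>Xi\<close>\<close>

lemma Xi_cases:
  assumes "\<xi> \<in> Xi"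
  obtains m where "\<xi> ^ (2 ^ m) = 1" "norm \<xi> = 1"
proof -
  obtain j :: int and m :: nat where \<xi>: "\<xi> = exp (2 * of_real pi * \<i> * of_int j / 2 ^ m)"
    using assms unfolding Xi_def by blast
  have "\<xi> ^ (2 ^ m) = exp (of_nat (2 ^ m) * (2 * of_real pi * \<i> * of_int j / 2 ^ m))"
    unfolding \<xi> by (simp only: exp_of_nat_mult)
  also have "\<dots> = exp (2 * of_int j * of_real pi * \<i>)" by (simp add: mult_ac)
  also have "\<dots> = 1" by (auto simp: exp_eq_1)
  finally have "\<xi> ^ (2 ^ m) = 1" .
  moreover from this have "norm \<xi> = 1" using power_eq_1_iff by fastforce
  ultimately show ?thesis by (rule that)
qed

lemma radial_limit_U0:
  assumes \<xi>: "\<xi> ^ (2 ^ m) = 1" "norm \<xi> = 1"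
  shows "((\<lambda>r::real. (deriv ^^ k) (eval_fps U0) (of_real r * \<xi>))
    \<longlongrightarrow> fact k * fps_nth (U_at \<xi>) k) (at_left 1)"
proof -
  \<comment> \<open>M is the order of vanishing that \<open>radial_limit_higher_deriv\<close> asks
    for; N = m + M makes \<open>summand_poly N\<close> divisible by the M-th power of q -
    xi.\<close>
  define M where "M = 2 * k + 2"
  define N where "N = m + M"
  define S where "S = (\<Sum>n<N. summand_poly n)"
  obtain R where R: "summand_poly N = [:-\<xi>, 1:] ^ M * R"
    using summand_poly_dvd[OF \<xi>(1), of N] by (auto simp: N_def elim: dvdE)
  define G where "G = fps_of_poly R * fps_compose U0 (fps_X ^ (2 ^ N))"
  have G: "poly_growth 0 G"
    unfolding G_def by (intro poly_growth_poly_mult poly_growth_U0_compose)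
  \<comment> \<open>The remainder of the N-fold iteration with its zero at xi split off; the
    cofactor G still has growth order 0.\<close>
  define E where "E = fps_of_poly ([:-\<xi>, 1:] ^ M) * G"
  have U0: "U0 = fps_of_poly S + E"
    using U0_expansion[of N] by (simp add: S_def E_def G_def R fps_of_poly_mult mult.assoc)
  have E: "fps_conv_radius ((fps_deriv ^^ k) E) \<ge> 1"
    using poly_growth_conv_radius[OF poly_growth_poly_mult[OF G]] fps_conv_radius_funpow_deriv[of E k]
    unfolding E_def by (rule order_trans)
  have S: "poly ((pderiv ^^ k) S) \<xi> = fact k * fps_nth (U_at \<xi>) k"
  proof -
    \<comment> \<open>With this many terms, the partial sum S already has the full k-th Taylor
      coefficient of U at xi.\<close>
    have "N \<ge> Suc (m + k)" by (simp add: N_def M_def)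
    from U_at_nth[OF \<xi>(1) this] show ?thesis
      by (simp add: poly_higher_pderiv_conv_pcompose S_def pcompose_sum coeff_sum U_summand_eq)
  qed
  \<comment> \<open>S contributes its value at xi by continuity of polynomials, and E contributes 0
    by its high-order zero.\<close>
  have "((\<lambda>r::real. poly ((pderiv ^^ k) S) (of_real r * \<xi>) +
      eval_fps ((fps_deriv ^^ k) E) (of_real r * \<xi>)) \<longlongrightarrow>
      poly ((pderiv ^^ k) S) (of_real 1 * \<xi>) + 0) (at_left 1)"
    unfolding E_def
    by (intro tendsto_add radial_limit_higher_deriv G \<xi>(2) tendsto_intros) (simp add: M_def)
  moreover have "\<forall>\<^sub>F r::real in at_left 1. r \<in> {0<..<1}"
    by (rule eventually_at_left_real) simp
  then have "\<forall>\<^sub>F r::real in at_left 1. poly ((pderiv ^^ k) S) (of_real r * \<xi>) +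
      eval_fps ((fps_deriv ^^ k) E) (of_real r * \<xi>) = (deriv ^^ k) (eval_fps U0) (of_real r * \<xi>)"
  proof eventually_elim
    case (elim r)
    then have "ereal (norm (of_real r * \<xi> :: complex)) < 1" using \<xi>(2) by (simp add: norm_mult)
    note order_less_le_trans[OF this E]
      and order_less_le_trans[OF this poly_growth_conv_radius[OF poly_growth_U0]]
    then show ?case
      by (simp add: higher_deriv_eval_fps)
        (simp add: U0 fps_deriv_funpow_add fps_deriv_funpow_of_poly eval_fps_add)
  qed
  ultimately show ?thesis
    using S by (auto intro: Lim_transform_eventually)
qed

theorem theorem1:
  shows "(\<exists>!F. mahler_eq F) \<and>
    fps_conv_radius U0 \<ge> 1 \<and>
    eval_fps U0 analytic_on ball 0 1 \<and>
    (\<forall>\<xi>\<in>Xi. summable (U_summand \<xi>) \<and>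
      (\<forall>k::nat. ((\<lambda>r::real. (deriv ^^ k) (eval_fps U0) (of_real r * \<xi>))
                  \<longlongrightarrow> fact k * fps_nth (U_at \<xi>) k) (at_left 1)))"
proof (intro conjI ballI allI)
  show "\<exists>!F. mahler_eq F" by (rule mahler_eq_ex1)
  show R: "fps_conv_radius U0 \<ge> 1"
    by (rule poly_growth_conv_radius[OF poly_growth_U0])
  show "eval_fps U0 analytic_on ball 0 1"
    using R by (intro analytic_on_eval_fps ball_eball_mono) (simp add: one_ereal_def)
  fix \<xi> assume "\<xi> \<in> Xi"
  then obtain m where \<xi>: "\<xi> ^ (2 ^ m) = 1" "norm \<xi> = 1" by (rule Xi_cases)
  show "summable (U_summand \<xi>)" using U_summand_sums[OF \<xi>(1)] by (rule sums_summable)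
  show "((\<lambda>r::real. (deriv ^^ k) (eval_fps U0) (of_real r * \<xi>))
      \<longlongrightarrow> fact k * fps_nth (U_at \<xi>) k) (at_left 1)" for k
    by (rule radial_limit_U0[OF \<xi>])
qed

end
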